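(* Let $\mathfrak P=(\mathbf I,\boldsymbol\lambda,A,C)$ be the parameter set of a DG-problem. For each $(\Lambda,D)\in SO(3)\times GL(2,\mathbb R)$, we have $$\Psi(\Lambda,D)_*\big(X_{\mathfrak P}(v)\big)=X_{\psi(\Lambda,D)(\mathfrak P)}\big(\Psi(\Lambda,D)(v)\big),\qquad v\in\mathbb R^3\times\mathcal O(C).$$
   Context: Notation. $L(n,k)$ is the space of real $n\times k$ matrices, $L(k)=L(k,k)$. For $\mathbf a_1,\mathbf a_2\in\mathbb R^3$, $j(\mathbf a_1,\mathbf a_2)\in L(3,2)$ is the matrix with columns $\mathbf a_1,\mathbf a_2$; for $A\in L(3,2)$, $\mathbf c_1(A),\mathbf c_2(A)\in\mathbb R^3$ are its columns. For $A,B\in L(3,2)$ and $\mathbf a\in\mathbb R^3$ put $A\times B=\sum_{i=1}^2\mathbf c_i(A)\times\mathbf c_i(B)\in\mathbb R^3$ and $\mathbf a\times A=j(\mathbf a\times\mathbf c_1(A),\mathbf a\times\mathbf c_2(A))\in L(3,2)$. DG-problem. Consider the equations $$\mathbf I\frac{d\boldsymbol\omega}{dt}=(\mathbf I\boldsymbol\omega+\boldsymbol\lambda)\times\boldsymbol\omega+A\times U,\qquad \frac{dU}{dt}=-\boldsymbol\omega\times U$$ for $(\boldsymbol\omega,U)\in\mathbb R^3\times L(3,2)$, where $\mathbf I\in L(3)$ is a constant inertia tensor (symmetric positive definite), $\boldsymbol\lambda\in\mathbb R^3$ and $A\in L(3,2)$ are constant. For a constant symmetric matrix $C\in L(2)$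 let $\mathcal O(C)=\{U\in L(3,2):U^TU=C\}$. The set $\mathbb R^3\times\mathcal O(C)$ is invariant; $\mathfrak P=(\mathbf I,\boldsymbol\lambda,A,C)$ denotes the complete set of parameters and $X_{\mathfrak P}$ the vector field induced on $\mathbb R^3\times\mathcal O(C)$ by these equations. The dynamical system $X_{\mathfrak P}$ is called the DG-problem with parameters $\mathfrak P$. For $\Lambda\in SO(3)$, $D\in GL(2,\mathbb R)$ define linear automorphisms of $\mathbb R^3\times L(3,2)$ and of $L(3)\times\mathbb R^3\times L(3,2)\times L(2)$: $$\Psi(\Lambda,D)(\boldsymbol\omega,U)=(\Lambda\boldsymbol\omega,\Lambda UD^T),\qquad \psi(\Lambda,D)(\mathbf I,\boldsymbol\lambda,A,C)=(\Lambda\mathbf I\Lambda^T,\Lambda\boldsymbol\lambda,\Lambda AD^{-1},DCD^T).$$ One has $\Psi(\Lambda,D)(\mathbb R^3\times\mathcal O(C))=\mathbb R^3\times\mathcal O(DCD^T)$. $\Psi_*$ denotes the differential (push-forward of tangent vectors). *)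

theory Defs
  imports "HOL-Analysis.Analysis"
begin

text \<open>\<open>L(n,k)\<close>, the real matrices with \<open>n\<close> rows and \<open>k\<close> columns, is \<open>real^'k^'n\<close>.\<close>

definition mat_of_cols :: "real^3 \<Rightarrow> real^3 \<Rightarrow> real^2^3" where
  "mat_of_cols a1 a2 = transpose (vector [a1, a2])"

lemma column_mat_of_cols:
  "column 1 (mat_of_cols a1 a2) = a1" "column 2 (mat_of_cols a1 a2) = a2"
  by (simp_all add: mat_of_cols_def column_def transpose_def vec_eq_iff)

definition mat_cross_mat :: "real^2^3 \<Rightarrow> real^2^3 \<Rightarrow> real^3" where
  "mat_cross_mat A B = (\<Sum>i\<in>UNIV. cross3 (column i A) (column i B))"

definition vec_cross_mat :: "real^3 \<Rightarrow> real^2^3 \<Rightarrow> real^2^3" where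
  "vec_cross_mat a A = mat_of_cols (cross3 a (column 1 A)) (cross3 a (column 2 A))"

type_synonym dg_state = "(real^3) \<times> (real^2^3)"
type_synonym dg_params = "(real^3^3) \<times> (real^3) \<times> (real^2^3) \<times> (real^2^2)"

definition symmetric_matrix :: "real^'n^'n \<Rightarrow> bool" where
  "symmetric_matrix M \<longleftrightarrow> transpose M = M"

definition positive_definite :: "real^'n^'n \<Rightarrow> bool" where
  "positive_definite M \<longleftrightarrow> (\<forall>x. x \<noteq> 0 \<longrightarrow> 0 < x \<bullet> (M *v x))"

fun dg_problem :: "dg_params \<Rightarrow> bool" where
  "dg_problem (J, l, A, C) \<longleftrightarrow>
     symmetric_matrix J \<and> positive_definite J \<and> symmetric_matrix C"

definition gram_fiber :: "real^2^2 \<Rightarrow> (real^2^3) set" where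
  "gram_fiber C = {U. transpose U ** U = C}"

fun phase_space :: "dg_params \<Rightarrow> dg_state set" where
  "phase_space (J, l, A, C) = UNIV \<times> gram_fiber C"

text \<open>The vector field lives on the phase space only: outside of it, the value is
  \<^const>\<open>undefined\<close>. The equation for \<open>\<omega>\<close> is solved for its derivative.\<close>

fun dg_field :: "dg_params \<Rightarrow> dg_state \<Rightarrow> dg_state" where
  "dg_field (J, l, A, C) =
     restrict (\<lambda>(\<omega>, U). (matrix_inv J *v (cross3 (J *v \<omega> + l) \<omega> + mat_cross_mat A U),
                         - vec_cross_mat \<omega> U))
       (phase_space (J, l, A, C))"

lemma positive_definite_invertible:
  assumes "positive_definite M"
  shows "invertible M"
proof -
  have "x = 0" if "M *v x = 0" for x
    using assms that unfolding positive_definite_def by force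
  then show ?thesis
    using invertible_left_inverse matrix_left_invertible_ker by blast
qed

lemma dg_field_iff:
  assumes "dg_problem (J, l, A, C)" and "(\<omega>, U) \<in> phase_space (J, l, A, C)"
  shows "dg_field (J, l, A, C) (\<omega>, U) = (\<omega>', U') \<longleftrightarrow>
     J *v \<omega>' = cross3 (J *v \<omega> + l) \<omega> + mat_cross_mat A U \<and> U' = - vec_cross_mat \<omega> U"
proof -
  have "invertible J"
    using assms(1) positive_definite_invertible by auto
  then have *: "J ** matrix_inv J = mat 1" "matrix_inv J ** J = mat 1"
    unfolding invertible_def matrix_inv_def by (metis (mono_tags, lifting) someI_ex)+
  have "matrix_inv J *v b = \<omega>' \<longleftrightarrow> J *v \<omega>' = b" for b
    using * by (metis matrix_vector_mul_assoc matrix_vector_mul_lid)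
  then show ?thesis
    using assms(2) by auto
qed

definition SO3 :: "(real^3^3) set" where
  "SO3 = {\<Lambda>. rotation_matrix \<Lambda>}"

definition GL2 :: "(real^2^2) set" where
  "GL2 = {D. invertible D}"

fun state_transform :: "real^3^3 \<Rightarrow> real^2^2 \<Rightarrow> dg_state \<Rightarrow> dg_state" where
  "state_transform \<Lambda> D (\<omega>, U) = (\<Lambda> *v \<omega>, \<Lambda> ** U ** transpose D)"

fun param_transform :: "real^3^3 \<Rightarrow> real^2^2 \<Rightarrow> dg_params \<Rightarrow> dg_params" where
  "param_transform \<Lambda> D (J, l, A, C) =
     (\<Lambda> ** J ** transpose \<Lambda>, \<Lambda> *v l, \<Lambda> ** A ** matrix_inv D, D ** C ** transpose D)"

lemma symmetric_matrix_congruence: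
  "symmetric_matrix N \<Longrightarrow> symmetric_matrix (M ** N ** transpose M)"
  by (simp add: symmetric_matrix_def matrix_transpose_mul matrix_mul_assoc)

lemma dg_problem_param_transform:
  assumes "dg_problem P" and "\<Lambda> \<in> SO3"
  shows "dg_problem (param_transform \<Lambda> D P)"
proof -
  obtain J l A C where P: "P = (J, l, A, C)"
    by (cases P)
  have "0 < x \<bullet> ((\<Lambda> ** J ** transpose \<Lambda>) *v x)" if "x \<noteq> 0" for x
  proof -
    have "\<Lambda> ** transpose \<Lambda> = mat 1"
      using assms(2) by (simp add: SO3_def rotation_matrix_def orthogonal_matrix_def)
    then have "transpose \<Lambda> *v x \<noteq> 0"
      using that by (metis matrix_vector_mul_assoc matrix_vector_mul_lid matrix_vector_mult_0_right)
    then have "0 < (transpose \<Lambda> *v x) \<bullet> (J *v (transpose \<Lambda> *v x))"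
      using assms(1) by (simp add: P positive_definite_def)
    also have "\<dots> = x \<bullet> (\<Lambda> *v (J *v (transpose \<Lambda> *v x)))"
      by (metis dot_lmul_matrix transpose_matrix_vector)
    finally show ?thesis
      by (simp only: matrix_vector_mul_assoc matrix_mul_assoc)
  qed
  then show ?thesis
    using assms(1) symmetric_matrix_congruence[of J \<Lambda>] symmetric_matrix_congruence[of C D] by (simp add: P positive_definite_def)
qed

text \<open>The phase space is embedded in a normed space, so the push-forward of its tangent vectors
  is given by the derivative of the ambient map.\<close>

definition push_forward ::
    "('a::real_normed_vector \<Rightarrow> 'b::real_normed_vector) \<Rightarrow> 'a \<Rightarrow> 'a \<Rightarrow> 'b" where
  "push_forward F v = frechet_derivative F (at v)"

end

theory Submission
  imports Defs
begin

text \<open>The map \<^term>\<open>state_transform \<Lambda> D\<close> is linear, hence equal to its own derivative, and the claim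
  is that it intertwines the two vector fields. This rests on how the products of the equations
  behave under the two factors of the group.

  The rotation acts on the left of every matrix, that is, on each column, and a rotation is an
  automorphism of the cross product; so all the products are equivariant under \<open>\<Lambda>\<close>
  (\<open>mat_cross_mat_rotation\<close>, \<open>vec_cross_mat_rotation\<close>).

  The matrix \<open>D\<close> acts on the right. The operation \<open>U \<mapsto> a \<times> U\<close> is left multiplication by a fixed
  matrix and commutes with right multiplication (\<open>vec_cross_mat_mult_right\<close>). In the torque
  \<open>A \<times> U\<close>, a factor to the right of \<open>A\<close> can be moved to \<open>U\<close> as its transpose
  (\<open>mat_cross_mat_adjoint\<close>); since \<open>A\<close> receives the inverse of \<open>D\<close> and \<open>U\<close> its transpose, the two
  cancel and the torque does not feel \<open>D\<close>.

  To avoid inverting the transformed inertia tensor, the transformed equations are checked in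
  their implicit form \<open>J \<omega>' = \<dots>\<close>, which determines the value of the vector field because the
  transformed tensor is again positive definite.\<close>

lemma column_matrix_mult: "column i (A ** M) = A *v column i M"
  by (simp add: column_def matrix_matrix_mult_def matrix_vector_mult_def)

lemma matrix_mult_minus_right: "A ** (- M) = - (A ** M)" for A :: "'a::ring_1^'n^'m"
  by (simp add: matrix_matrix_mult_def vec_eq_iff sum_negf)

lemma matrix_mult_minus_left: "(- M) ** A = - (M ** A)" for A :: "'a::ring_1^'n^'m"
  by (simp add: matrix_matrix_mult_def vec_eq_iff sum_negf)

lemma column_vec_cross_mat: "column i (vec_cross_mat a U) = cross3 a (column i U)"
  using exhaust_2[of i] by (auto simp: vec_cross_mat_def column_mat_of_cols)

lemma mat_cross_mat_rotation:
  assumes "rotation_matrix \<Lambda>"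
  shows "mat_cross_mat (\<Lambda> ** A) (\<Lambda> ** U) = \<Lambda> *v mat_cross_mat A U"
  by (simp add: mat_cross_mat_def column_matrix_mult cross_rotation_matrix[OF assms]
      matrix_vector_right_distrib sum_2)

lemma vec_cross_mat_rotation:
  assumes "rotation_matrix \<Lambda>"
  shows "vec_cross_mat (\<Lambda> *v a) (\<Lambda> ** U) = \<Lambda> ** vec_cross_mat a U"
proof -
  have "column i (vec_cross_mat (\<Lambda> *v a) (\<Lambda> ** U)) = column i (\<Lambda> ** vec_cross_mat a U)" for i
    by (simp add: column_vec_cross_mat column_matrix_mult cross_rotation_matrix[OF assms])
  then show ?thesis
    by (simp add: column_def vec_eq_iff)
qed

text \<open>By associativity of the matrix product: \<^term>\<open>vec_cross_mat a\<close> is left multiplication by the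
  matrix of the linear map \<^term>\<open>cross3 a\<close>.\<close>

lemma vec_cross_mat_mult_right: "vec_cross_mat a (U ** M) = vec_cross_mat a U ** M"
proof -
  have "linear (cross3 a)"
    using bilinear_cross by (simp add: bilinear_def)
  then have *: "column i (vec_cross_mat a V) = column i (matrix (cross3 a) ** V)" for i V
    by (simp add: column_vec_cross_mat column_matrix_mult matrix_works)
  have "vec_cross_mat a V = matrix (cross3 a) ** V" for V
    using *[of _ V] by (simp add: column_def vec_eq_iff)
  then show ?thesis
    by (simp add: matrix_mul_assoc)
qed

text \<open>Both sides equal the sum of \<^term>\<open>M $ k $ i *\<^sub>R cross3 (column k A) (column i U)\<close> over \<open>i\<close> and
  \<open>k\<close>, by bilinearity of the cross product.\<close>

lemma mat_cross_mat_adjoint: "mat_cross_mat (A ** M) U = mat_cross_mat A (U ** transpose M)"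
  by (simp add: mat_cross_mat_def cross3_def column_def matrix_matrix_mult_def transpose_def
      vec_eq_iff forall_3 sum_2 algebra_simps)

lemma mat_cross_mat_mult_inverse:
  assumes "invertible D"
  shows "mat_cross_mat (A ** matrix_inv D) (U ** transpose D) = mat_cross_mat A U"
proof -
  have "transpose D ** transpose (matrix_inv D) = mat 1"
    using assms unfolding invertible_def matrix_inv_def
    by (metis (mono_tags, lifting) someI_ex matrix_transpose_mul transpose_mat)
  then show ?thesis
    by (simp add: mat_cross_mat_adjoint flip: matrix_mul_assoc)
qed

lemma linear_state_transform: "linear (state_transform \<Lambda> D)"
  by (rule linearI)
    (auto simp: matrix_vector_right_distrib matrix_add_ldistrib matrix_vector_mult_scaleR
      matrix_matrix_mult_def vec_eq_iff sum.distrib sum_distrib_left sum_distrib_right algebra_simps)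

lemma push_forward_linear:
  fixes F :: "'a::euclidean_space \<Rightarrow> 'b::real_normed_vector"
  assumes "linear F"
  shows "push_forward F v = F"
  unfolding push_forward_def
  using frechet_derivative_at[OF linear_imp_has_derivative[OF assms]] by simp

text \<open>In the Gram matrix of \<^term>\<open>\<Lambda> ** U ** transpose D\<close> the rotation cancels, being orthogonal.
  Were the new state outside the new phase space, the right-hand side of the theorem would be
  \<^const>\<open>undefined\<close>.\<close>

lemma state_transform_phase_space:
  assumes "\<Lambda> \<in> SO3" and "v \<in> phase_space P"
  shows "state_transform \<Lambda> D v \<in> phase_space (param_transform \<Lambda> D P)"
proof -
  obtain J l A C \<omega> U where [simp]: "P = (J, l, A, C)" "v = (\<omega>, U)"
    by (metis prod_cases4 surj_pair)
  have orth: "transpose \<Lambda> ** \<Lambda> = mat 1"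
    using assms(1) by (simp add: SO3_def rotation_matrix_def orthogonal_matrix_def)
  have "transpose (\<Lambda> ** U ** transpose D) ** (\<Lambda> ** U ** transpose D)
      = D ** transpose U ** (transpose \<Lambda> ** \<Lambda>) ** U ** transpose D"
    by (simp add: matrix_transpose_mul matrix_mul_assoc)
  also have "\<dots> = D ** (transpose U ** U) ** transpose D"
    by (simp add: orth matrix_mul_assoc)
  finally show ?thesis
    using assms(2) by (simp add: gram_fiber_def)
qed

theorem lemma2:
  fixes P :: dg_params and \<Lambda> :: "real^3^3" and D :: "real^2^2" and v :: dg_state
  assumes "dg_problem P"
    and "\<Lambda> \<in> SO3" and "D \<in> GL2"
    and "v \<in> phase_space P"
  shows "push_forward (state_transform \<Lambda> D) v (dg_field P v) =
    dg_field (param_transform \<Lambda> D P) (state_transform \<Lambda> D v)"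
proof -
  obtain J l A C \<omega> U where P: "P = (J, l, A, C)" and v: "v = (\<omega>, U)"
    by (metis prod_cases4 surj_pair)
  obtain \<omega>' U' where X: "dg_field P v = (\<omega>', U')"
    by fastforce
  have eq\<omega>: "J *v \<omega>' = cross3 (J *v \<omega> + l) \<omega> + mat_cross_mat A U"
    and eqU: "U' = - vec_cross_mat \<omega> U"
    using dg_field_iff[of J l A C \<omega> U \<omega>' U'] assms(1,4) X by (simp_all add: P v)
  have rot: "rotation_matrix \<Lambda>" and D: "invertible D"
    using assms(2,3) by (simp_all add: SO3_def GL2_def)
  have "transpose \<Lambda> ** \<Lambda> = mat 1"
    using rot by (simp add: rotation_matrix_def orthogonal_matrix_def)
  then have inertia: "(\<Lambda> ** J ** transpose \<Lambda>) *v (\<Lambda> *v x) = \<Lambda> *v (J *v x)" for x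
    by (simp add: matrix_vector_mul_assoc flip: matrix_mul_assoc)
  have torque: "mat_cross_mat (\<Lambda> ** A ** matrix_inv D) (\<Lambda> ** U ** transpose D)
      = \<Lambda> *v mat_cross_mat A U"
    by (simp add: mat_cross_mat_mult_inverse[OF D] mat_cross_mat_rotation[OF rot])
  have "(\<Lambda> ** J ** transpose \<Lambda>) *v (\<Lambda> *v \<omega>')
      = cross3 ((\<Lambda> ** J ** transpose \<Lambda>) *v (\<Lambda> *v \<omega>) + \<Lambda> *v l) (\<Lambda> *v \<omega>)
        + mat_cross_mat (\<Lambda> ** A ** matrix_inv D) (\<Lambda> ** U ** transpose D)"
    by (simp add: inertia torque eq\<omega> cross_rotation_matrix[OF rot]
        flip: matrix_vector_right_distrib)
  moreover have "\<Lambda> ** U' ** transpose D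
      = - vec_cross_mat (\<Lambda> *v \<omega>) (\<Lambda> ** U ** transpose D)"
    by (simp add: eqU vec_cross_mat_mult_right vec_cross_mat_rotation[OF rot]
        matrix_mult_minus_right matrix_mult_minus_left)
  ultimately have "dg_field (param_transform \<Lambda> D P) (state_transform \<Lambda> D v)
      = state_transform \<Lambda> D (\<omega>', U')"
    using dg_problem_param_transform[OF assms(1,2), of D]
      state_transform_phase_space[OF assms(2,4), of D]
    unfolding P v param_transform.simps state_transform.simps
    by (subst dg_field_iff) auto
  then show ?thesis
    by (simp add: X push_forward_linear[OF linear_state_transform])
qed

end
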